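(* Let $\mathfrak{m}$ be a convex polygon in $\mathbb{R}^2$ with vertex set $\{\mathbf{v}_i\}$. Given any set of generalized barycentric coordinates $\{\lambda_i\}$ associated to $\mathfrak{m}$, with $\mathcal{W}_{ij}:=\lambda_i\nabla\lambda_j-\lambda_j\nabla\lambda_i$, $$\sum_{i<j}(\operatorname{rot}\mathcal{W}_{ij})\,\bigl(\operatorname{rot}(\mathbf{v}_j-\mathbf{v}_i)\bigr)^T=\mathbb{I},$$ where $\mathbb{I}$ is the $2\times2$ identity matrix. Further, $$\sum_{i<j}\bigl((\operatorname{rot}\mathbf{v}_i)\cdot\mathbf{v}_j\bigr)\operatorname{rot}\mathcal{W}_{ij}=-\mathbf{x}.$$ Thus, $\operatorname{span}\{\operatorname{rot}\mathcal{W}_{ij} : \mathbf{v}_i,\mathbf{v}_j\in\mathfrak{m}\}\supseteq\mathcal{P}_1^-\Lambda^1(\mathfrak{m})$, where $\mathcal{P}_1^-\Lambda^1(\mathfrak{m})$ is identified with the space of vector fields $\{\mathbf{c}+s\,\mathbf{x} : \mathbf{c}\in\mathbb{R}^2,\ s\in\mathbb{R}\}$.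
   Context: Generalized barycentric coordinates on $\mathfrak{m}$: non-negative functions $\lambda_i:\mathfrak{m}\to\mathbb{R}$, one for each vertex $\mathbf{v}_i$, such that every linear function $L$ (polynomial of degree at most 1) satisfies $L=\sum_i L(\mathbf{v}_i)\lambda_i$ on $\mathfrak{m}$. The vertices are indexed by an ordered finite set, and $\sum_{i<j}$ runs over pairs of vertex indices with $i<j$. Vectors (vertices, gradients, and the position $\mathbf{x}=(x_1,x_2)^T$) are column vectors; $\mathbf{v}_i\in\mathfrak{m}$ in the span refers to vertices of $\mathfrak{m}$. The operator $\operatorname{rot}$ is left multiplication by the matrix $\begin{bmatrix}0&-1\\1&0\end{bmatrix}$. The $\lambda_i$ are assumed differentiable wherever gradients are written: the identities and the span inclusion are understood as statements about functions of $\mathbf{x}$ on the set of points of $\mathfrak{m}$ at which all $\lambda_i$ are differentiable relative to $\mathfrak{m}$ (i.e. $\lambda_i(\mathbf{y})=\lambda_i(\mathbf{x})+\nabla\lambda_i(\mathbf{x})\cdot(\mathbf{y}-\mathbf{x})+o(|\mathbf{y}-\mathbf{x}|)$ for $\mathbf{y}\in\mathfrak{m}$). $\mathcal{P}_1^-\Lambda^1:=\mathcal{P}_0\Lambda^1\oplus\kappa\mathcal{H}_0\Lambda^2$, where $\mathcal{P}_0\Lambda^1$ is the space of 1-forms with constant coefficients, $\mathcal{H}_0\Lambda^2$ is spanned by $dx_1\wedge dx_2$, and $\kappa(dx_1\wedge dx_2)=x_1dx_2-x_2dx_1$. Here 1-forms are identified with $H(\operatorname{div})$-type vector fields by $u_1dx_1+u_2dx_2\leftrightarrow\operatorname{rot}(u_1,u_2)^T$,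 under which $\mathcal{P}_1^-\Lambda^1$ is the lowest-order Raviart–Thomas space $\{\mathbf{c}+s\mathbf{x}\}$. Span means finite real linear combinations. *)

theory Defs
  imports "HOL-Analysis.Analysis" "HOL-Library.Function_Algebras"
begin

text \<open>Pointwise scalar multiplication makes functions into a real vector space, so that
  \<^term>\<open>span\<close> applies to sets of vector fields and of differential forms.\<close>

instantiation "fun" :: (type, real_vector) real_vector
begin

definition scaleR_fun :: "real \<Rightarrow> ('a \<Rightarrow> 'b) \<Rightarrow> 'a \<Rightarrow> 'b" where
  "scaleR_fun r f = (\<lambda>x. r *\<^sub>R f x)"

instance
  by standard (simp_all add: scaleR_fun_def fun_eq_iff scaleR_add_right scaleR_add_left)

end

text \<open>A polygon is two-dimensional: segments, points and the empty set are excluded.\<close>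

definition convex_polygon :: "(real^2) set \<Rightarrow> bool" where
  "convex_polygon m \<longleftrightarrow> polytope m \<and> interior m \<noteq> {}"

definition vertices :: "(real^2) set \<Rightarrow> (real^2) set" where
  "vertices m = {x. x extreme_point_of m}"

definition generalized_barycentric ::
  "(real^2) set \<Rightarrow> 'i set \<Rightarrow> ('i \<Rightarrow> real^2) \<Rightarrow> ('i \<Rightarrow> real^2 \<Rightarrow> real) \<Rightarrow> bool" where
  "generalized_barycentric m I v lam \<longleftrightarrow>
     (\<forall>i\<in>I. \<forall>x\<in>m. 0 \<le> lam i x) \<and>
     (\<forall>a b. let L = (\<lambda>x. a \<bullet> x + b) in \<forall>x\<in>m. L x = (\<Sum>i\<in>I. L (v i) * lam i x))"

definition rot :: "real^2 \<Rightarrow> real^2" where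
  "rot u = (vector [vector [0, -1], vector [1, 0]] :: real^2^2) *v u"

text \<open>Differentiability and gradients are relative to the set \<open>m\<close>; for convex
  \<open>m\<close> with nonempty interior the relative derivative is unique also at boundary points.\<close>

definition diff_points :: "(real^2) set \<Rightarrow> 'i set \<Rightarrow> ('i \<Rightarrow> real^2 \<Rightarrow> real) \<Rightarrow> (real^2) set" where
  "diff_points m I lam = {x \<in> m. \<forall>i\<in>I. lam i differentiable (at x within m)}"

definition grad :: "(real^2) set \<Rightarrow> (real^2 \<Rightarrow> real) \<Rightarrow> real^2 \<Rightarrow> real^2" where
  "grad m f x = (\<chi> k. frechet_derivative f (at x within m) (axis k 1))"

definition whitney ::
  "(real^2) set \<Rightarrow> ('i \<Rightarrow> real^2 \<Rightarrow> real) \<Rightarrow> 'i \<Rightarrow> 'i \<Rightarrow> real^2 \<Rightarrow> real^2" where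
  "whitney m lam i j x = lam i x *\<^sub>R grad m (lam j) x - lam j x *\<^sub>R grad m (lam i) x"

text \<open>Functions on \<open>D\<close> are represented by their extensions by zero.\<close>

definition restrict0 :: "'a set \<Rightarrow> ('a \<Rightarrow> 'b::zero) \<Rightarrow> 'a \<Rightarrow> 'b" where
  "restrict0 D f = (\<lambda>x. if x \<in> D then f x else 0)"

text \<open>A 1-form (2-form) takes a base point and one (two) tangent vectors.\<close>

type_synonym form1 = "real^2 \<Rightarrow> real^2 \<Rightarrow> real"
type_synonym form2 = "real^2 \<Rightarrow> real^2 \<Rightarrow> real^2 \<Rightarrow> real"

definition dx :: "2 \<Rightarrow> form1" where
  "dx k = (\<lambda>x u. u $ k)"

definition wedge :: "form1 \<Rightarrow> form1 \<Rightarrow> form2" where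
  "wedge \<alpha> \<beta> = (\<lambda>x u w. \<alpha> x u * \<beta> x w - \<alpha> x w * \<beta> x u)"

text \<open>The Koszul operator contracts with the position vector field.\<close>

definition koszul :: "form2 \<Rightarrow> form1" where
  "koszul \<omega> = (\<lambda>x u. \<omega> x x u)"

definition P0_form1 :: "form1 set" where
  "P0_form1 = span {dx 1, dx 2}"

definition H0_form2 :: "form2 set" where
  "H0_form2 = span {wedge (dx 1) (dx 2)}"

definition P1minus_form1 :: "form1 set" where
  "P1minus_form1 = {\<alpha> + koszul \<omega> | \<alpha> \<omega>. \<alpha> \<in> P0_form1 \<and> \<omega> \<in> H0_form2}"

text \<open>The \<open>H(div)\<close> identification of \<open>u\<^sub>1 dx\<^sub>1 + u\<^sub>2 dx\<^sub>2\<close> with the rotated coefficient field.\<close>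

definition proxy :: "form1 \<Rightarrow> real^2 \<Rightarrow> real^2" where
  "proxy \<omega> = (\<lambda>x. rot (\<chi> k. \<omega> x (axis k 1)))"

lemma rot_nth [simp]: "rot u $ 1 = - (u $ 2)" "rot u $ 2 = u $ 1"
  by (simp_all add: rot_def matrix_vector_mult_def sum_2)

lemma koszul_wedge_dx:
  "koszul (wedge (dx 1) (dx 2)) = (\<lambda>x u. x $ 1 * dx 2 x u - x $ 2 * dx 1 x u)"
  by (simp add: koszul_def wedge_def dx_def fun_eq_iff mult.commute)

lemma P0_form1_eq: "P0_form1 = {\<lambda>x u. a * u $ 1 + b * u $ 2 | a b. True}"
proof -
  have "f \<in> P0_form1 \<longleftrightarrow> (\<exists>a b. f = a *\<^sub>R dx 1 + b *\<^sub>R dx 2)" for f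
    unfolding P0_form1_def span_breakdown_eq span_empty singleton_iff
    by (simp only: diff_diff_eq right_minus_eq)
  moreover have "a *\<^sub>R dx 1 + b *\<^sub>R dx 2 = (\<lambda>x u. a * u $ 1 + b * u $ 2)" for a b
    by (simp add: dx_def scaleR_fun_def fun_eq_iff)
  ultimately show ?thesis by auto
qed

lemma koszul_H0_form2_eq:
  "koszul ` H0_form2 = {\<lambda>x u. s * (x $ 1 * u $ 2 - x $ 2 * u $ 1) | s. True}"
proof -
  have "koszul (s *\<^sub>R wedge (dx 1) (dx 2)) = (\<lambda>x u. s * (x $ 1 * u $ 2 - x $ 2 * u $ 1))" for s
    by (simp add: koszul_def wedge_def dx_def scaleR_fun_def fun_eq_iff algebra_simps)
  moreover have H: "H0_form2 = range (\<lambda>s. s *\<^sub>R wedge (dx 1) (dx 2))"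
    unfolding H0_form2_def by (simp add: span_singleton)
  ultimately show ?thesis unfolding H image_image by auto
qed

text \<open>The sum in \<^const>\<open>P1minus_form1\<close> is direct.\<close>

lemma P1minus_form1_direct: "P0_form1 \<inter> koszul ` H0_form2 = {0}"
proof (intro equalityI subsetI)
  fix f assume "f \<in> P0_form1 \<inter> koszul ` H0_form2"
  then obtain a b s where f: "f = (\<lambda>x u. a * u $ 1 + b * u $ 2)"
    and g: "f = (\<lambda>x u. s * (x $ 1 * u $ 2 - x $ 2 * u $ 1))"
    unfolding P0_form1_eq koszul_H0_form2_eq by blast
  have "f x = f 0" for x by (simp add: f)
  moreover have "f 0 u = 0" for u by (simp add: g)
  ultimately show "f \<in> {0}" by (simp add: fun_eq_iff)
next
  fix f :: form1 assume "f \<in> {0}"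
  then have "f \<in> P0_form1" "f \<in> koszul ` H0_form2"
    unfolding P0_form1_eq koszul_H0_form2_eq
    by (auto simp: fun_eq_iff intro!: exI[of _ 0])
  then show "f \<in> P0_form1 \<inter> koszul ` H0_form2" by simp
qed

text \<open>The proxy fields form the lowest-order Raviart--Thomas space.\<close>

lemma proxy_P1minus_form1: "proxy ` P1minus_form1 = {\<lambda>x. c + s *\<^sub>R x | c s. True}"
proof -
  have eq: "proxy ((\<lambda>x u. a * u $ 1 + b * u $ 2) + (\<lambda>x u. s * (x $ 1 * u $ 2 - x $ 2 * u $ 1)))
      = (\<lambda>x. vector [-b, a] + (-s) *\<^sub>R x)" for a b s
    by (simp add: proxy_def fun_eq_iff vec_eq_iff forall_2 axis_def)
  have P: "P1minus_form1 = {f + g | f g. f \<in> P0_form1 \<and> g \<in> koszul ` H0_form2}"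
    unfolding P1minus_form1_def by blast
  show ?thesis
  proof (intro equalityI subsetI)
    fix F assume "F \<in> proxy ` P1minus_form1"
    then show "F \<in> {\<lambda>x. c + s *\<^sub>R x | c s. True}"
      unfolding P P0_form1_eq koszul_H0_form2_eq using eq by blast
  next
    fix F :: "real^2 \<Rightarrow> real^2" assume "F \<in> {\<lambda>x. c + s *\<^sub>R x | c s. True}"
    then obtain c s where F: "F = (\<lambda>x. c + s *\<^sub>R x)" by blast
    have "vector [- (- c $ 1), c $ 2] = c" by (simp add: vec_eq_iff forall_2)
    then have "F = proxy ((\<lambda>x u. c $ 2 * u $ 1 + (- c $ 1) * u $ 2)
        + (\<lambda>x u. (-s) * (x $ 1 * u $ 2 - x $ 2 * u $ 1)))"
      unfolding eq F by simp
    then show "F \<in> proxy ` P1minus_form1"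
      unfolding P P0_form1_eq koszul_H0_form2_eq by blast
  qed
qed

end

theory Submission
  imports Defs
begin

text \<open>Differentiating the reproduction identity \<open>\<Sum>\<^sub>j L(v\<^sub>j) \<lambda>\<^sub>j = L\<close> gives
  \<open>\<Sum>\<^sub>j L(v\<^sub>j) \<nabla>\<lambda>\<^sub>j = \<nabla>L\<close> for every affine \<open>L\<close>. For an antisymmetric coefficient
  matrix \<open>c\<close>, the sum of \<open>c\<^sub>i\<^sub>j W\<^sub>i\<^sub>j\<close> over \<open>i < j\<close> is the full double sum of
  \<open>c\<^sub>i\<^sub>j \<lambda>\<^sub>i \<nabla>\<lambda>\<^sub>j\<close>; if \<open>c\<^sub>i\<^sub>j\<close> is affine in \<open>v\<^sub>i\<close> and in \<open>v\<^sub>j\<close> separately,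
  the sum over \<open>i\<close> replaces \<open>v\<^sub>i\<close> by \<open>x\<close> and the sum over \<open>j\<close> then yields the gradient
  of the affine function of \<open>v\<^sub>j\<close> that remains.\<close>

text \<open>The square \<open>I \<times> I\<close> splits into two triangles and the diagonal;
  swapping coordinates folds the lower triangle onto the upper one.\<close>

lemma sum_less_pairs:
  fixes I :: "'i::linorder set" and f :: "'i \<Rightarrow> 'i \<Rightarrow> 'a::comm_monoid_add"
  assumes "finite I" and "\<And>i. i \<in> I \<Longrightarrow> f i i = 0"
  shows "(\<Sum>i\<in>I. \<Sum>j\<in>I. f i j) = (\<Sum>(i, j) | i \<in> I \<and> j \<in> I \<and> i < j. f i j + f j i)"
proof -
  let ?A = "{(i, j). i \<in> I \<and> j \<in> I \<and> i < j}"
  let ?D = "{(i, j). i \<in> I \<and> j \<in> I \<and> i = j}"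
  let ?B = "{(i, j). i \<in> I \<and> j \<in> I \<and> j < i}"
  have fin: "finite ?A" "finite ?B" "finite ?D"
    using assms(1) by (auto intro: finite_subset[of _ "I \<times> I"])
  have "(\<Sum>i\<in>I. \<Sum>j\<in>I. f i j) = (\<Sum>(i, j) \<in> I \<times> I. f i j)"
    by (simp add: sum.cartesian_product)
  also have "I \<times> I = (?A \<union> ?B) \<union> ?D" by auto
  also have "(\<Sum>(i, j) \<in> (?A \<union> ?B) \<union> ?D. f i j)
      = (\<Sum>(i, j) \<in> ?A. f i j) + (\<Sum>(i, j) \<in> ?B. f i j) + (\<Sum>(i, j) \<in> ?D. f i j)"
    using fin by (subst sum.union_disjoint; (subst sum.union_disjoint)?; auto)
  also have "(\<Sum>(i, j) \<in> ?D. f i j) = 0"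
    using assms(2) by (intro sum.neutral) auto
  also have "(\<Sum>(i, j) \<in> ?B. f i j) = (\<Sum>(i, j) \<in> ?A. f j i)"
    by (rule sum.reindex_bij_witness[where i = prod.swap and j = prod.swap]) auto
  finally show ?thesis by (simp add: sum.distrib case_prod_unfold)
qed

text \<open>Here \<open>l\<close> and \<open>g\<close> stand for the values and the gradients of the
  coordinates at one fixed point, so the bracket is a Whitney field evaluated there.\<close>

lemma sum_antisym_less_pairs:
  fixes I :: "'i::linorder set" and g :: "'i \<Rightarrow> 'a::real_vector"
  assumes "finite I" and anti: "\<And>i j. c j i = - c i j"
  shows "(\<Sum>(i, j) | i \<in> I \<and> j \<in> I \<and> i < j. c i j *\<^sub>R (l i *\<^sub>R g j - l j *\<^sub>R g i))
       = (\<Sum>j\<in>I. (\<Sum>i\<in>I. c i j * l i) *\<^sub>R g j)"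
proof -
  have "c i i = 0" for i using anti[of i i] by simp
  then have "(\<Sum>i\<in>I. \<Sum>j\<in>I. (c i j * l i) *\<^sub>R g j)
      = (\<Sum>(i, j) | i \<in> I \<and> j \<in> I \<and> i < j. (c i j * l i) *\<^sub>R g j + (c j i * l j) *\<^sub>R g i)"
    using \<open>finite I\<close> by (intro sum_less_pairs) simp_all
  also have "\<dots> = (\<Sum>(i, j) | i \<in> I \<and> j \<in> I \<and> i < j. c i j *\<^sub>R (l i *\<^sub>R g j - l j *\<^sub>R g i))"
  proof (intro sum.cong refl, clarify)
    fix i j
    show "(c i j * l i) *\<^sub>R g j + (c j i * l j) *\<^sub>R g i = c i j *\<^sub>R (l i *\<^sub>R g j - l j *\<^sub>R g i)"
      using anti[of j i] by (simp add: scaleR_diff_right)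
  qed
  finally show ?thesis
    by (subst (asm) sum.swap) (simp add: scaleR_sum_left)
qed

text \<open>At a boundary point \<open>x\<close> the derivative vanishes only along \<open>y - x\<close> with \<open>y \<in> S\<close> at first;
  these directions span because \<open>S\<close> contains a ball.\<close>

lemma has_derivative_zero_within_convex:
  fixes D :: "'a::real_normed_vector \<Rightarrow> 'b::real_normed_vector"
  assumes "convex S" and "interior S \<noteq> {}" and "x \<in> S"
    and D: "((\<lambda>_. 0) has_derivative D) (at x within S)"
  shows "D h = 0"
proof -
  interpret D: bounded_linear D using D by (rule has_derivative_bounded_linear)
  have dir: "D (y - x) = 0" if "y \<in> S" for y
  proof -
    \<comment> \<open>The segment from \<open>x\<close> to \<open>y\<close> stays in
      \<open>S\<close> by convexity, which reduces the claim to a one-sided derivative in one real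
      variable at 0.\<close>
    let ?g = "\<lambda>t::real. x + t *\<^sub>R (y - x)"
    have "?g ` {0..1} \<subseteq> S"
    proof clarify
      fix t :: real assume "t \<in> {0..1}"
      then have "(1 - t) *\<^sub>R x + t *\<^sub>R y \<in> S"
        using \<open>convex S\<close> \<open>x \<in> S\<close> \<open>y \<in> S\<close> by (simp add: convexD_alt)
      then show "?g t \<in> S" by (simp add: algebra_simps)
    qed
    then have "((\<lambda>_. 0) has_derivative D) (at (?g 0) within ?g ` {0..1})"
      using D by (auto intro: has_derivative_subset)
    moreover have "(?g has_derivative (\<lambda>t. t *\<^sub>R (y - x))) (at 0 within {0..1})"
      by (auto intro!: derivative_eq_intros)
    ultimately have "((\<lambda>_. 0) has_derivative (\<lambda>t. D (t *\<^sub>R (y - x)))) (at 0 within {0..1})"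
      using has_derivative_in_compose by fastforce
    then have "((\<lambda>_. 0) has_vector_derivative D (y - x)) (at 0 within {0..1})"
      by (simp add: has_vector_derivative_def D.scaleR)
    then show ?thesis
      by (rule vector_derivative_unique_within[rotated])
        (simp_all add: trivial_limit_within islimpt_Icc)
  qed
  obtain z e where "0 < e" and ball: "ball z e \<subseteq> S"
    using \<open>interior S \<noteq> {}\<close> by (auto simp: mem_interior)
  show ?thesis
  proof (cases "h = 0")
    case False
    \<comment> \<open>This scale puts \<open>z + t *\<^sub>R h\<close> at distance
      \<open>e / 2\<close> from \<open>z\<close>, inside the ball. Then \<open>t *\<^sub>R h\<close>
      is a difference of two directions from \<open>x\<close> into \<open>S\<close>, and
      \<open>D\<close> vanishes on both.\<close>
    define t where "t = e / (2 * norm h)"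
    have "t > 0" using False \<open>0 < e\<close> by (simp add: t_def)
    have "z + t *\<^sub>R h \<in> ball z e" "z \<in> ball z e"
      using False \<open>0 < e\<close> by (auto simp: t_def dist_norm)
    then have "D (z + t *\<^sub>R h - x) = 0" "D (z - x) = 0" using ball dir by blast+
    then have "t *\<^sub>R D h = 0" by (simp add: D.add D.diff D.scaleR)
    with \<open>t > 0\<close> show ?thesis by simp
  qed simp
qed

lemma generalized_barycentricD:
  assumes "generalized_barycentric m I v lam" and "x \<in> m"
  shows "(\<Sum>i\<in>I. (a \<bullet> v i + b) * lam i x) = a \<bullet> x + b"
  using assms by (simp add: generalized_barycentric_def Let_def)

lemma generalized_barycentric_grad:
  assumes "convex m" and "interior m \<noteq> {}"
    and bary: "generalized_barycentric m I v lam" and x: "x \<in> diff_points m I lam"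
  shows "(\<Sum>i\<in>I. (a \<bullet> v i + b) *\<^sub>R grad m (lam i) x) = a"
proof -
  let ?D = "\<lambda>i. frechet_derivative (lam i) (at x within m)"
  have xm: "x \<in> m" using x by (simp add: diff_points_def)
  have "(lam i has_derivative ?D i) (at x within m)" if "i \<in> I" for i
    using x that by (simp add: diff_points_def frechet_derivative_works)
  then have "((\<lambda>y. (\<Sum>i\<in>I. (a \<bullet> v i + b) * lam i y) - (a \<bullet> y + b)) has_derivative
      (\<lambda>h. (\<Sum>i\<in>I. (a \<bullet> v i + b) * ?D i h) - a \<bullet> h)) (at x within m)"
    by (auto intro!: derivative_eq_intros)
  \<comment> \<open>The reproduction identity makes the differentiated function zero on all of
    \<open>m\<close>, and a derivative within \<open>m\<close> sees only values on
    \<open>m\<close>.\<close>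
  then have "((\<lambda>_. 0) has_derivative (\<lambda>h. (\<Sum>i\<in>I. (a \<bullet> v i + b) * ?D i h) - a \<bullet> h))
      (at x within m)"
    by (rule has_derivative_transform[OF xm, rotated])
      (simp add: generalized_barycentricD[OF bary])
  from has_derivative_zero_within_convex[OF assms(1,2) xm this]
  have "(\<Sum>i\<in>I. (a \<bullet> v i + b) * ?D i h) = a \<bullet> h" for h by simp
  then show ?thesis by (simp add: vec_eq_iff grad_def inner_axis)
qed

lemma linear_rot: "linear rot"
  unfolding rot_def by (rule matrix_vector_mul_linear)

lemma rot_rot [simp]: "rot (rot u) = - u"
  by (simp add: vec_eq_iff forall_2)

text \<open>The matrix of \<open>rot\<close> is skew-symmetric. This gives the antisymmetry of the
  coefficients in \<open>i\<close> and \<open>j\<close> for both identities.\<close>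

lemma rot_inner: "rot u \<bullet> w = - (rot w \<bullet> u)"
  by (simp add: inner_vec_def sum_2)

text \<open>Both identities are instances that differ only in \<open>c\<close>. Summing over
  \<open>i\<close> must leave an affine function of \<open>v j\<close>; its gradient
  \<open>a\<close> survives, while \<open>b\<close> drops out because the gradients of the
  coordinates sum to zero.\<close>

lemma sum_whitney:
  fixes I :: "'i::linorder set"
  assumes "finite I" and "\<And>i j. c j i = - c i j"
    and conv: "convex m" "interior m \<noteq> {}" and bary: "generalized_barycentric m I v lam"
    and x: "x \<in> diff_points m I lam"
    and c: "\<And>j. j \<in> I \<Longrightarrow> (\<Sum>i\<in>I. c i j * lam i x) = a \<bullet> v j + b"
  shows "(\<Sum>(i, j) | i \<in> I \<and> j \<in> I \<and> i < j. c i j *\<^sub>R rot (whitney m lam i j x)) = rot a"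
proof -
  have "(\<Sum>(i, j) | i \<in> I \<and> j \<in> I \<and> i < j. c i j *\<^sub>R whitney m lam i j x)
      = (\<Sum>j\<in>I. (a \<bullet> v j + b) *\<^sub>R grad m (lam j) x)"
    using c by (simp add: whitney_def sum_antisym_less_pairs[OF assms(1,2)])
  also have "\<dots> = a" by (rule generalized_barycentric_grad[OF conv bary x])
  finally have "rot (\<Sum>(i, j) | i \<in> I \<and> j \<in> I \<and> i < j. c i j *\<^sub>R whitney m lam i j x) = rot a"
    by simp
  then show ?thesis
    by (simp add: linear_sum[OF linear_rot] linear_scale[OF linear_rot] case_prod_unfold)
qed

theorem corollary4p7:
  fixes m :: "(real^2) set"
    and I :: "'i::linorder set"
    and v :: "'i \<Rightarrow> real^2"
    and lam :: "'i \<Rightarrow> real^2 \<Rightarrow> real"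
  assumes "convex_polygon m"
    and "finite I"
    and "bij_betw v I (vertices m)"
    and "generalized_barycentric m I v lam"
  shows "(\<forall>x \<in> diff_points m I lam.
            (\<Sum>(i, j) | i \<in> I \<and> j \<in> I \<and> i < j.
               (columnvector (rot (whitney m lam i j x)) :: real^1^2) **
               (rowvector (rot (v j - v i)) :: real^2^1)) = mat 1)
       \<and> (\<forall>x \<in> diff_points m I lam.
            (\<Sum>(i, j) | i \<in> I \<and> j \<in> I \<and> i < j.
               (rot (v i) \<bullet> v j) *\<^sub>R rot (whitney m lam i j x)) = - x)
       \<and> restrict0 (diff_points m I lam) ` proxy ` P1minus_form1
           \<subseteq> span {restrict0 (diff_points m I lam) (\<lambda>x. rot (whitney m lam i j x)) | i j.
                     i \<in> I \<and> j \<in> I}"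
proof -
  have conv: "convex m" "interior m \<noteq> {}"
    using assms(1) by (auto simp: convex_polygon_def polytope_imp_convex)
  note bary = assms(4)
  let ?P = "{(i, j). i \<in> I \<and> j \<in> I \<and> i < j}"
  let ?W = "\<lambda>i j x. rot (whitney m lam i j x)"
  let ?D = "diff_points m I lam"
  \<comment> \<open>This is the matrix identity applied to an arbitrary vector \<open>a\<close>. It
    serves twice: for the entries of the matrix and for the constant fields in the span.\<close>
  have const: "(\<Sum>(i, j) \<in> ?P. (rot (v j - v i) \<bullet> a) *\<^sub>R ?W i j x) = a" if x: "x \<in> ?D" for x a
  proof -
    have xm: "x \<in> m" using x by (simp add: diff_points_def)
    have "(\<Sum>(i, j) \<in> ?P. (rot (v j - v i) \<bullet> a) *\<^sub>R ?W i j x) = rot (- rot a)"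
    proof (rule sum_whitney[OF assms(2) _ conv bary x])
      fix j
      \<comment> \<open>Skew-symmetry moves \<open>rot\<close> onto \<open>a\<close>, which displays
        the coefficient as an affine function of \<open>v i\<close>, ready to be reproduced at
        \<open>x\<close>. The gradient left in \<open>v j\<close> is \<open>- rot a\<close>, and
        \<open>rot\<close> turns it back into \<open>a\<close>.\<close>
      have "(\<Sum>i\<in>I. (rot (v j - v i) \<bullet> a) * lam i x)
          = (\<Sum>i\<in>I. (rot a \<bullet> v i + - (rot a \<bullet> v j)) * lam i x)"
        by (simp add: rot_inner[of "v j - v i" a for i] inner_diff_right)
      also have "\<dots> = - rot a \<bullet> v j + rot a \<bullet> x"
        by (simp only: generalized_barycentricD[OF bary xm]) simp
      finally show "(\<Sum>i\<in>I. (rot (v j - v i) \<bullet> a) * lam i x) = - rot a \<bullet> v j + rot a \<bullet> x" .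
    qed (simp add: rot_inner[of "w - z" a for w z] inner_diff_right)
    then show ?thesis by (simp add: linear_neg[OF linear_rot])
  qed
  have pos: "(\<Sum>(i, j) \<in> ?P. (rot (v i) \<bullet> v j) *\<^sub>R ?W i j x) = - x" if x: "x \<in> ?D" for x
  proof -
    have xm: "x \<in> m" using x by (simp add: diff_points_def)
    \<comment> \<open>Replacing \<open>v i\<close> by \<open>x\<close> leaves the linear function of
      \<open>v j\<close> with gradient \<open>rot x\<close>; a second \<open>rot\<close> gives the
      sign in \<open>- x\<close>.\<close>
    have "(\<Sum>(i, j) \<in> ?P. (rot (v i) \<bullet> v j) *\<^sub>R ?W i j x) = rot (rot x)"
    proof (rule sum_whitney[OF assms(2) _ conv bary x])
      fix j
      show "(\<Sum>i\<in>I. (rot (v i) \<bullet> v j) * lam i x) = rot x \<bullet> v j + 0"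
        using generalized_barycentricD[OF bary xm, of "- rot (v j)" 0]
        by (simp add: rot_inner[of "v i" "v j" for i] rot_inner[of x "v j"])
    qed (rule rot_inner)
    then show ?thesis by simp
  qed
  have "(\<Sum>(i, j) \<in> ?P. (columnvector (?W i j x) :: real^1^2) **
      (rowvector (rot (v j - v i)) :: real^2^1)) = mat 1" if x: "x \<in> ?D" for x
  proof -
    have "(\<Sum>(i, j) \<in> ?P. (columnvector (?W i j x) :: real^1^2) **
        (rowvector (rot (v j - v i)) :: real^2^1)) $ k $ l = (mat 1 :: real^2^2) $ k $ l" for k l
    proof -
      \<comment> \<open>Taking \<open>a\<close> to be the basis vector \<open>axis l 1\<close>
        extracts column \<open>l\<close> of the matrix sum.\<close>
      have "(\<Sum>(i, j) \<in> ?P. rot (v j - v i) $ l * ?W i j x $ k) = axis l 1 $ k"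
        using arg_cong[OF const[OF x, of "axis l 1"], of "\<lambda>u. u $ k"]
        by (simp add: case_prod_unfold inner_axis)
      then show ?thesis
        by (simp add: case_prod_unfold matrix_matrix_mult_def columnvector_def rowvector_def
            mat_def axis_def mult.commute)
    qed
    then show ?thesis by (simp add: vec_eq_iff)
  qed
  moreover have "restrict0 ?D ` proxy ` P1minus_form1
      \<subseteq> span {restrict0 ?D (\<lambda>x. ?W i j x) | i j. i \<in> I \<and> j \<in> I}" (is "_ \<subseteq> span ?S")
    unfolding proxy_P1minus_form1
  proof clarify
    fix c s
    \<comment> \<open>The first term produces \<open>c\<close>. The second carries a minus sign
      because the position identity yields \<open>- x\<close>.\<close>
    let ?k = "\<lambda>i j. rot (v j - v i) \<bullet> c - s * (rot (v i) \<bullet> v j)"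
    have eval: "(\<Sum>p\<in>A. F p) x = (\<Sum>p\<in>A. F p x)"
      for A and F :: "'i \<times> 'i \<Rightarrow> real^2 \<Rightarrow> real^2" and x
      by (induction A rule: infinite_finite_induct) simp_all
    have "restrict0 ?D (\<lambda>x. c + s *\<^sub>R x) = (\<Sum>(i, j) \<in> ?P. ?k i j *\<^sub>R restrict0 ?D (?W i j))"
    proof
      fix x
      show "restrict0 ?D (\<lambda>x. c + s *\<^sub>R x) x
          = (\<Sum>(i, j) \<in> ?P. ?k i j *\<^sub>R restrict0 ?D (?W i j)) x"
      proof (cases "x \<in> ?D")
        case True
        have "(\<Sum>(i, j) \<in> ?P. ?k i j *\<^sub>R ?W i j x)
            = (\<Sum>(i, j) \<in> ?P. (rot (v j - v i) \<bullet> c) *\<^sub>R ?W i j x)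
              - s *\<^sub>R (\<Sum>(i, j) \<in> ?P. (rot (v i) \<bullet> v j) *\<^sub>R ?W i j x)"
          by (simp add: case_prod_unfold scaleR_sum_right sum_subtractf scaleR_diff_left)
        also have "\<dots> = c + s *\<^sub>R x" by (simp only: const[OF True] pos[OF True]) simp
        finally show ?thesis
          using True by (simp add: eval restrict0_def scaleR_fun_def case_prod_unfold)
      next
        case False
        then show ?thesis by (simp add: eval restrict0_def scaleR_fun_def case_prod_unfold)
      qed
    qed
    also have "\<dots> \<in> span ?S"
      by (rule span_sum) (clarify, rule span_scale, rule span_base, blast)
    finally show "restrict0 ?D (\<lambda>x. c + s *\<^sub>R x) \<in> span ?S" .
  qed
  ultimately show ?thesis using pos by blast
qed

end
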